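(* Let $p,q\in\mathbb{F}[t]$ be monic polynomials of degree $2$, and assume that both $p$ and $q$ are split over $\mathbb{F}$ with a double root. Let $v$ be a $(p,q)$-exceptional endomorphism of a vector space over $\mathbb{F}$. Then $S(v)$ is a symplectic $(p,q)$-difference.
   Context: $\mathbb{F}$ is an arbitrary field (characteristic $2$ allowed), with a fixed algebraic closure $\overline{\mathbb{F}}$; all vector spaces are finite-dimensional over $\mathbb{F}$. $\operatorname{Root}(r)$ is the set of roots of $r$ in $\overline{\mathbb{F}}$; $\operatorname{Root}(p)-\operatorname{Root}(q):=\{x-y : x\in\operatorname{Root}(p),\,y\in\operatorname{Root}(q)\}$. An endomorphism is $(p,q)$-exceptional if all its eigenvalues in $\overline{\mathbb{F}}$ belong to $\operatorname{Root}(p)-\operatorname{Root}(q)$. A symplectic form is a non-degenerate alternating bilinear form. Given a symplectic form $b$ on $V$, an endomorphism $u$ of $V$ is $b$-alternating if $b(x,u(x))=0$ for all $x\in V$. A symplectic pair $(b,u)$ consists of a symplectic form $b$ on a vector space and a $b$-alternating endomorphism $u$ of it. It is a symplectic $(p,q)$-difference if there are $b$-alternating endomorphisms $u_1,u_2$ with $u=u_1-u_2$, $p(u_1)=0$ and $q(u_2)=0$. For an endomorphism $v$ of $V$ with transpose $v^t:\varphi\mapsto\varphi\circ v$ on the dual space $V^\star$, put $h(v):=v\oplus v^t$ on $V\times V^\star$ and $S_V((x,\varphi),(y,\psi)):=\varphi(y)-\psi(x)$. The symplectic extension of $v$ is the symplectic pair $S(v):=(S_V,h(v))$. *)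

theory Defs
  imports
    "HOL-Library.Function_Algebras"
    "HOL-Library.Product_Plus"
    "HOL-Algebra.Algebraic_Closure_Type"
    "Jordan_Normal_Form.Char_Poly"
begin

section \<open>Roots and eigenvalues in the algebraic closure\<close>

definition Root :: "'a::field poly \<Rightarrow> 'a alg_closure set" where
  "Root r = {z. poly (map_poly to_ac r) z = 0}"

definition Root_diff :: "'a::field poly \<Rightarrow> 'a poly \<Rightarrow> 'a alg_closure set" where
  "Root_diff p q = {x - y | x y. x \<in> Root p \<and> y \<in> Root q}"

definition ordered_basis ::
    "('a::field \<Rightarrow> 'b::ab_group_add \<Rightarrow> 'b) \<Rightarrow> 'b list \<Rightarrow> bool" where
  "ordered_basis s bs \<longleftrightarrow>
     distinct bs \<and> \<not> module.dependent s (set bs) \<and> module.span s (set bs) = UNIV"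

definition matrix_of ::
    "('a::field \<Rightarrow> 'b::ab_group_add \<Rightarrow> 'b) \<Rightarrow> 'b list \<Rightarrow> ('b \<Rightarrow> 'b) \<Rightarrow> 'a mat" where
  "matrix_of s bs v =
     mat (length bs) (length bs)
       (\<lambda>(i, j). module.representation s (set bs) (v (bs ! j)) (bs ! i))"

text \<open>
  The eigenvalues of an endomorphism in the algebraic closure are those of its scalar extension,
  i.e. of any matrix representing it, read over the closure. Matrices with respect to different
  bases are similar, so the existential over bases does not enlarge the set.
\<close>

definition closure_eigenvalues ::
    "('a::field \<Rightarrow> 'b::ab_group_add \<Rightarrow> 'b) \<Rightarrow> ('b \<Rightarrow> 'b) \<Rightarrow> 'a alg_closure set" where
  "closure_eigenvalues s v =
     {z. \<exists>bs. ordered_basis s bs \<and> eigenvalue (map_mat to_ac (matrix_of s bs v)) z}"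

definition exceptional ::
    "('a::field \<Rightarrow> 'b::ab_group_add \<Rightarrow> 'b) \<Rightarrow> 'a poly \<Rightarrow> 'a poly \<Rightarrow> ('b \<Rightarrow> 'b) \<Rightarrow> bool" where
  "exceptional s p q v \<longleftrightarrow> closure_eigenvalues s v \<subseteq> Root_diff p q"

section \<open>Symplectic pairs\<close>

text \<open>
  The space \<open>V \<times> V\<^sup>\<star>\<close> is not a whole type, so the notions below are relative to a subspace \<open>W\<close> of an
  ambient vector space with scalar multiplication \<open>s\<close>. Maps and forms are functions on the ambient
  type of which only the values on \<open>W\<close> matter.
\<close>

definition findim_space :: "('a::field \<Rightarrow> 'c::ab_group_add \<Rightarrow> 'c) \<Rightarrow> 'c set \<Rightarrow> bool" where
  "findim_space s W \<longleftrightarrow>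
     vector_space s \<and> module.subspace s W \<and> (\<exists>B. finite B \<and> module.span s B = W)"

definition endomorphism_on ::
    "('a::field \<Rightarrow> 'c::ab_group_add \<Rightarrow> 'c) \<Rightarrow> 'c set \<Rightarrow> ('c \<Rightarrow> 'c) \<Rightarrow> bool" where
  "endomorphism_on s W u \<longleftrightarrow>
     (\<forall>x\<in>W. u x \<in> W) \<and>
     (\<forall>x\<in>W. \<forall>y\<in>W. u (x + y) = u x + u y) \<and>
     (\<forall>c. \<forall>x\<in>W. u (s c x) = s c (u x))"

definition bilinear_form_on ::
    "('a::field \<Rightarrow> 'c::ab_group_add \<Rightarrow> 'c) \<Rightarrow> 'c set \<Rightarrow> ('c \<Rightarrow> 'c \<Rightarrow> 'a) \<Rightarrow> bool" where
  "bilinear_form_on s W b \<longleftrightarrow>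
     (\<forall>x\<in>W. \<forall>y\<in>W. \<forall>z\<in>W. b (x + y) z = b x z + b y z \<and> b z (x + y) = b z x + b z y) \<and>
     (\<forall>c. \<forall>x\<in>W. \<forall>y\<in>W. b (s c x) y = c * b x y \<and> b x (s c y) = c * b x y)"

definition symplectic_form_on ::
    "('a::field \<Rightarrow> 'c::ab_group_add \<Rightarrow> 'c) \<Rightarrow> 'c set \<Rightarrow> ('c \<Rightarrow> 'c \<Rightarrow> 'a) \<Rightarrow> bool" where
  "symplectic_form_on s W b \<longleftrightarrow>
     bilinear_form_on s W b \<and>
     (\<forall>x\<in>W. b x x = 0) \<and>
     (\<forall>x\<in>W. (\<forall>y\<in>W. b x y = 0) \<longrightarrow> x = 0)"

definition alternating_endo_on ::
    "('a::field \<Rightarrow> 'c::ab_group_add \<Rightarrow> 'c) \<Rightarrow> 'c set \<Rightarrow> ('c \<Rightarrow> 'c \<Rightarrow> 'a) \<Rightarrow> ('c \<Rightarrow> 'c) \<Rightarrow> bool" where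
  "alternating_endo_on s W b u \<longleftrightarrow> endomorphism_on s W u \<and> (\<forall>x\<in>W. b x (u x) = 0)"

definition symplectic_pair ::
    "('a::field \<Rightarrow> 'c::ab_group_add \<Rightarrow> 'c) \<Rightarrow> 'c set \<Rightarrow>
     ('c \<Rightarrow> 'c \<Rightarrow> 'a) \<times> ('c \<Rightarrow> 'c) \<Rightarrow> bool" where
  "symplectic_pair s W = (\<lambda>(b, u).
     findim_space s W \<and> symplectic_form_on s W b \<and> alternating_endo_on s W b u)"

definition poly_endo ::
    "('a::field \<Rightarrow> 'c::ab_group_add \<Rightarrow> 'c) \<Rightarrow> 'a poly \<Rightarrow> ('c \<Rightarrow> 'c) \<Rightarrow> 'c \<Rightarrow> 'c" where
  "poly_endo s r u x = (\<Sum>i\<le>degree r. s (coeff r i) ((u ^^ i) x))"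

definition symplectic_difference ::
    "('a::field \<Rightarrow> 'c::ab_group_add \<Rightarrow> 'c) \<Rightarrow> 'c set \<Rightarrow> 'a poly \<Rightarrow> 'a poly \<Rightarrow>
     ('c \<Rightarrow> 'c \<Rightarrow> 'a) \<times> ('c \<Rightarrow> 'c) \<Rightarrow> bool" where
  "symplectic_difference s W p q = (\<lambda>(b, u).
     symplectic_pair s W (b, u) \<and>
     (\<exists>u\<^sub>1 u\<^sub>2. alternating_endo_on s W b u\<^sub>1 \<and> alternating_endo_on s W b u\<^sub>2 \<and>
        (\<forall>x\<in>W. u x = u\<^sub>1 x - u\<^sub>2 x) \<and>
        (\<forall>x\<in>W. poly_endo s p u\<^sub>1 x = 0) \<and>
        (\<forall>x\<in>W. poly_endo s q u\<^sub>2 x = 0)))"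

section \<open>The symplectic extension\<close>

definition dual_space :: "('a::field \<Rightarrow> 'b::ab_group_add \<Rightarrow> 'b) \<Rightarrow> ('b \<Rightarrow> 'a) set" where
  "dual_space s = {\<phi>. Vector_Spaces.linear s (*) \<phi>}"

definition ext_space :: "('a::field \<Rightarrow> 'b::ab_group_add \<Rightarrow> 'b) \<Rightarrow> ('b \<times> ('b \<Rightarrow> 'a)) set" where
  "ext_space s = UNIV \<times> dual_space s"

definition ext_scale ::
    "('a::field \<Rightarrow> 'b::ab_group_add \<Rightarrow> 'b) \<Rightarrow> 'a \<Rightarrow> 'b \<times> ('b \<Rightarrow> 'a) \<Rightarrow> 'b \<times> ('b \<Rightarrow> 'a)" where
  "ext_scale s c = (\<lambda>(x, \<phi>). (s c x, \<lambda>y. c * \<phi> y))"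

definition ext_form :: "'b \<times> ('b \<Rightarrow> 'a::field) \<Rightarrow> 'b \<times> ('b \<Rightarrow> 'a) \<Rightarrow> 'a" where
  "ext_form = (\<lambda>(x, \<phi>) (y, \<psi>). \<phi> y - \<psi> x)"

definition ext_endo :: "('b \<Rightarrow> 'b) \<Rightarrow> 'b \<times> ('b \<Rightarrow> 'a::field) \<Rightarrow> 'b \<times> ('b \<Rightarrow> 'a)" where
  "ext_endo v = (\<lambda>(x, \<phi>). (v x, \<phi> \<circ> v))"

definition symplectic_extension ::
    "('b \<Rightarrow> 'b) \<Rightarrow>
     ('b \<times> ('b \<Rightarrow> 'a::field) \<Rightarrow> 'b \<times> ('b \<Rightarrow> 'a) \<Rightarrow> 'a) \<times>
     ('b \<times> ('b \<Rightarrow> 'a) \<Rightarrow> 'b \<times> ('b \<Rightarrow> 'a))" where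
  "symplectic_extension v = (ext_form, ext_endo v)"

end

theory Submission
  imports Defs
begin

text \<open>
  Writing \<open>p = (t - a)\<^sup>2\<close> and \<open>q = (t - b)\<^sup>2\<close>, the only possible eigenvalue of \<open>v\<close> is \<open>a - b\<close>, so
  \<open>n = v - (a - b)\<close> is nilpotent. A nilpotent endomorphism is a sum \<open>g + h\<close> of two endomorphisms of
  square zero: split the space as \<open>W\<^sub>0 \<oplus> W\<^sub>1\<close> with \<open>n\<close> exchanging the two summands, and let \<open>g\<close> and \<open>h\<close>
  agree with \<open>n\<close> on one summand and vanish on the other. Then \<open>v = (a + g) - (b - h)\<close>, where \<open>p\<close>
  annihilates \<open>a + g\<close> and \<open>q\<close> annihilates \<open>b - h\<close>, and \<open>u \<mapsto> u \<oplus> u\<^sup>t\<close> carries this decomposition to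
  \<open>S(v)\<close>, since every \<open>u \<oplus> u\<^sup>t\<close> is alternating for the canonical form.
\<close>

section \<open>Nilpotent matrices and eigenvalues over the algebraic closure\<close>

text \<open>
  If \<open>D = \<Sum> B\<^sub>i X\<^sup>i\<close> is the adjugate of \<open>X - A\<close>, comparing coefficients in \<open>D (X - A) = X\<^sup>n\<close> gives
  \<open>B\<^sub>k = B\<^sub>k\<^sub>+\<^sub>1 A\<close> except at \<open>k = n - 1\<close>, hence \<open>B\<^sub>i = A\<^sup>n\<^sup>-\<^sup>1\<^sup>-\<^sup>i\<close> for \<open>i < n\<close>, and finally \<open>B\<^sub>0 A = 0\<close>.
\<close>

lemma nilpotent_if_char_poly_monom:
  fixes A :: "'a::comm_ring_1 mat"
  assumes A: "A \<in> carrier_mat n n" and cp: "char_poly A = monom 1 n"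
  shows "A ^\<^sub>m n = 0\<^sub>m n n"
proof (cases "n = 0")
  case True
  then show ?thesis using A by (intro eq_matI) auto
next
  case False
  define D where "D = adj_mat (char_poly_matrix A)"
  define B where "B i = map_mat (\<lambda>p. coeff p i) D" for i
  have X: "char_poly_matrix A \<in> carrier_mat n n" using A by simp
  have D: "D \<in> carrier_mat n n" using adj_mat(1)[OF X] by (simp add: D_def)
  have B: "B i \<in> carrier_mat n n" for i using D by (simp add: B_def)
  have prod: "D * char_poly_matrix A = monom 1 n \<cdot>\<^sub>m 1\<^sub>m n"
    using adj_mat(3)[OF X] cp by (simp add: D_def char_poly_def)
  \<comment> \<open>Coefficient of X^m in the identity D (X - A) = X^n, entry by entry. The
    \<open>case\<close> encodes the convention that \<open>B\<close> vanishes at index -1.\<close>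
  have step: "(B m * A) $$ (i, j) =
      (case m of 0 \<Rightarrow> 0 | Suc k \<Rightarrow> B k $$ (i, j)) - (if m = n \<and> i = j then 1 else 0)"
    if ij: "i < n" "j < n" for m i j
  proof -
    have "(D * char_poly_matrix A) $$ (i, j) =
        (\<Sum>k<n. D $$ (i, k) * ((if k = j then [:0, 1:] else 0) + [:- A $$ (k, j):]))"
      using ij A D X by (auto simp: scalar_prod_def char_poly_matrix_def lessThan_atLeast0 intro!: sum.cong)
    also have "\<dots> = (\<Sum>k<n. if k = j then D $$ (i, k) * [:0, 1:] else 0) +
        (\<Sum>k<n. D $$ (i, k) * [:- A $$ (k, j):])"
      by (subst sum.distrib[symmetric]) (auto intro!: sum.cong simp: ring_distribs)
    also have "(\<Sum>k<n. if k = j then D $$ (i, k) * [:0, 1:] else 0) = pCons 0 (D $$ (i, j))"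
      using ij by (subst sum.delta) auto
    finally have "coeff ((D * char_poly_matrix A) $$ (i, j)) m =
        coeff (pCons 0 (D $$ (i, j))) m - (\<Sum>k<n. coeff (D $$ (i, k)) m * A $$ (k, j))"
      by (simp add: coeff_sum sum_negf mult.commute)
    moreover have "(B m * A) $$ (i, j) = (\<Sum>k<n. coeff (D $$ (i, k)) m * A $$ (k, j))"
      using ij A D by (auto simp: scalar_prod_def B_def lessThan_atLeast0 intro!: sum.cong)
    moreover have "coeff ((D * char_poly_matrix A) $$ (i, j)) m = (if m = n \<and> i = j then 1 else 0)"
      using ij by (simp add: prod)
    moreover have "coeff (pCons 0 (D $$ (i, j))) m = (case m of 0 \<Rightarrow> 0 | Suc k \<Rightarrow> B k $$ (i, j))"
      using ij D by (auto simp: B_def coeff_pCons split: nat.split)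
    ultimately show ?thesis by (simp add: algebra_simps)
  qed
  have down: "B k = B (Suc k) * A" if "Suc k \<noteq> n" for k
  proof (rule eq_matI)
    show "B k $$ (i, j) = (B (Suc k) * A) $$ (i, j)"
      if "i < dim_row (B (Suc k) * A)" "j < dim_col (B (Suc k) * A)" for i j
      using that step[of i j "Suc k"] \<open>Suc k \<noteq> n\<close> A B[of "Suc k"] by simp
  qed (use A B[of k] B[of "Suc k"] in auto)
  \<comment> \<open>\<open>N\<close> exceeds the degree of every entry of \<open>D\<close>, so
    \<open>B\<close> vanishes from index \<open>N\<close> on.\<close>
  define N where "N = Suc (Max (insert n {degree (D $$ (i, j)) | i j. i < n \<and> j < n}))"
  have fin: "finite {degree (D $$ (i, j)) | i j. i < n \<and> j < n}"
    by (rule finite_image_set2) auto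
  have large: "B k = 0\<^sub>m n n" if "k \<ge> N" for k
  proof -
    have "degree (D $$ (i, j)) < N" if "i < n" "j < n" for i j
      unfolding N_def less_Suc_eq_le using fin that by (intro Max_ge) auto
    then have "coeff (D $$ (i, j)) k = 0" if "i < n" "j < n" for i j
      using that \<open>k \<ge> N\<close> by (intro coeff_eq_0) (meson less_le_trans)
    then show ?thesis using D by (intro eq_matI) (auto simp: B_def)
  qed
  \<comment> \<open>Vanishing descends from \<open>N\<close> to \<open>n\<close> through
    \<open>down\<close>: as long as \<open>k\<close> is at least \<open>n\<close>, the excluded
    index \<open>Suc k = n\<close> is not met.\<close>
  have zero: "B k = 0\<^sub>m n n" if "k \<ge> n" for k
  proof (cases "k \<ge> N")
    case False
    then have "k \<le> N" by simp
    then show ?thesis using that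
    proof (induction k rule: inc_induct)
      case base
      show ?case by (rule large) simp
    next
      case (step k)
      then show ?case using down[of k] A by simp
    qed
  qed (rule large)
  \<comment> \<open>Since \<open>B n\<close> is zero, the entry identity at \<open>m = n\<close>
    leaves exactly the identity matrix for \<open>B (n - 1)\<close>.\<close>
  have top: "B (n - 1) = 1\<^sub>m n"
  proof (rule eq_matI)
    show "B (n - 1) $$ (i, j) = 1\<^sub>m n $$ (i, j)" if "i < dim_row (1\<^sub>m n)" "j < dim_col (1\<^sub>m n)" for i j
      using that step[of i j n] False zero[of n] A by (auto split: nat.splits)
  qed (use B[of "n - 1"] in auto)
  have pow: "B (n - 1 - k) = A ^\<^sub>m k" if "k < n" for k
    using that
  proof (induction k)
    case 0
    then show ?case using top A by simp
  next
    case (Suc k)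
    then show ?case
      using down[of "n - 1 - Suc k"] by (simp add: Suc_diff_Suc)
  qed
  have "B 0 * A = 0\<^sub>m n n"
    using step[of _ _ 0] False A B[of 0] by (intro eq_matI) auto
  moreover have "B 0 = A ^\<^sub>m (n - 1)" using pow[of "n - 1"] False by simp
  moreover obtain l where "n = Suc l" using False by (cases n) auto
  ultimately show ?thesis by simp
qed

text \<open>Over an algebraically closed field a monic polynomial is a product of factors X - x with
  x a root, and here each factor is X.\<close>

lemma poly_eq_monom_if_all_roots_0:
  fixes p :: "'a::alg_closed_field poly"
  assumes monic: "lead_coeff p = 1" and roots: "\<And>x. poly p x = 0 \<Longrightarrow> x = 0"
  shows "p = monom 1 (degree p)"
proof -
  have "p \<noteq> 0" using monic by auto
  then obtain R where R: "size R = degree p" "p = (\<Prod>x\<in>#R. [:-x, 1:])"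
    using alg_closed_imp_factorization[of p] monic by auto
  have "x = 0" if "x \<in># R" for x
  proof (rule roots)
    show "poly p x = 0" using that by (subst R(2)) (auto simp: poly_prod_mset prod_mset_zero_iff)
  qed
  then have R_eq: "R = replicate_mset (degree p) 0"
    using R(1) by (metis set_mset_subset_singletonD singletonI subsetI)
  have "(\<Prod>x\<in>#R. [:-x, 1:]) = monom 1 (degree p)"
    by (subst R_eq) (simp add: monom_altdef)
  then show ?thesis by (rule trans[OF R(2)])
qed

lemma nilpotent_if_eigenvalues_0:
  fixes A :: "'a::alg_closed_field mat"
  assumes A: "A \<in> carrier_mat n n" and ev: "\<And>k. eigenvalue A k \<Longrightarrow> k = 0"
  shows "A ^\<^sub>m n = 0\<^sub>m n n"
proof (rule nilpotent_if_char_poly_monom[OF A])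
  show "char_poly A = monom 1 n"
    using poly_eq_monom_if_all_roots_0[of "char_poly A"] degree_monic_char_poly[OF A]
      ev eigenvalue_root_char_poly[OF A] by auto
qed

text \<open>Subtracting \<open>c\<close> shifts the eigenvalues, so over the closure only 0 can
  remain and the shifted matrix is nilpotent there. This descends to the base field because
  \<open>to_ac\<close> is an injective ring homomorphism.\<close>

lemma nilpotent_if_single_closure_eigenvalue:
  fixes M :: "'a::field mat"
  assumes M: "M \<in> carrier_mat n n"
    and ev: "\<And>z. eigenvalue (map_mat to_ac M) z \<Longrightarrow> z = to_ac c"
  shows "(M - c \<cdot>\<^sub>m 1\<^sub>m n) ^\<^sub>m n = 0\<^sub>m n n"
proof -
  interpret to_ac: inj_comm_ring_hom "to_ac :: 'a \<Rightarrow> 'a alg_closure"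
    by unfold_locales auto
  let ?N = "M - c \<cdot>\<^sub>m 1\<^sub>m n"
  have N: "?N \<in> carrier_mat n n" using M by (intro minus_carrier_mat) auto
  have eq: "map_mat to_ac ?N = map_mat to_ac M - to_ac c \<cdot>\<^sub>m 1\<^sub>m n"
    using M by (intro eq_matI) auto
  have "map_mat to_ac ?N ^\<^sub>m n = 0\<^sub>m n n"
  proof (rule nilpotent_if_eigenvalues_0)
    show "map_mat to_ac ?N \<in> carrier_mat n n" using N by simp
    fix k assume "eigenvalue (map_mat to_ac ?N) k"
    then obtain x where x: "x \<in> carrier_vec n" "x \<noteq> 0\<^sub>v n" "map_mat to_ac ?N *\<^sub>v x = k \<cdot>\<^sub>v x"
      using N by (auto simp: eigenvalue_def eigenvector_def)
    have one: "(to_ac c \<cdot>\<^sub>m 1\<^sub>m n) *\<^sub>v x = to_ac c \<cdot>\<^sub>v x"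
      using x(1) by (intro eq_vecI) auto
    have "map_mat to_ac ?N *\<^sub>v x = map_mat to_ac M *\<^sub>v x - to_ac c \<cdot>\<^sub>v x"
      unfolding eq using M x(1)
      by (subst minus_mult_distrib_mat_vec[of _ n n]) (auto simp: one)
    then have "map_mat to_ac M *\<^sub>v x = (k + to_ac c) \<cdot>\<^sub>v x"
      using x M by (auto simp: vec_eq_iff algebra_simps)
    then have "eigenvalue (map_mat to_ac M) (k + to_ac c)"
      using x M by (auto simp: eigenvalue_def eigenvector_def)
    then show "k = 0" using ev by force
  qed
  then have "map_mat to_ac (?N ^\<^sub>m n) = map_mat to_ac (0\<^sub>m n n)"
    using to_ac.mat_hom_pow[OF N, of n] by (auto intro!: eq_matI)
  then show ?thesis by (rule to_ac.mat_hom_inj)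
qed

section \<open>Splitting a nilpotent endomorphism into two of square zero\<close>

context vector_space
begin

text \<open>A linear projection \<open>g\<close> onto R + S exists, and the vectors of
  \<open>T\<close> that it sends into \<open>R\<close> form the complement of
  \<open>S\<close>.\<close>

lemma subspace_complement_containing:
  assumes R: "subspace R" and S: "subspace S" and T: "subspace T"
    and "R \<subseteq> T" "S \<subseteq> T" "R \<inter> S \<subseteq> {0}"
  obtains C where "subspace C" "R \<subseteq> C" "C \<subseteq> T" "C \<inter> S \<subseteq> {0}"
    "\<And>t. t \<in> T \<Longrightarrow> \<exists>c\<in>C. \<exists>s\<in>S. t = c + s"
proof -
  interpret pair: vector_space_pair scale scale ..
  let ?Q = "{x + y | x y. x \<in> R \<and> y \<in> S}"
  have Q: "subspace ?Q" by (rule subspace_sums[OF R S])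
  \<comment> \<open>A left inverse of the identity on \<open>?Q\<close> with range in
    \<open>?Q\<close> is such a projection.\<close>
  have "\<exists>g. g ` UNIV \<subseteq> ?Q \<and> Vector_Spaces.linear scale scale g \<and> (\<forall>x\<in>?Q. g (id x) = x)"
    by (rule pair.linear_exists_left_inverse_on[OF _ Q]) (auto simp: linear_ident)
  then obtain g where g: "range g \<subseteq> ?Q" "Vector_Spaces.linear scale scale g"
    and gid: "\<And>x. x \<in> ?Q \<Longrightarrow> g x = x" by auto
  interpret g: Vector_Spaces.linear scale scale g by fact
  have gR: "g x = x" if "x \<in> R" for x
    using that subspace_0[OF S] by (intro gid) force
  have gS: "g x = x" if "x \<in> S" for x
    using that subspace_0[OF R] by (intro gid) force
  define C where "C = {t \<in> T. g t \<in> R}"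
  show ?thesis
  proof
    show "subspace C" unfolding C_def
      by (rule subspaceI)
        (auto simp: g.add g.scale subspace_0[OF R] subspace_0[OF T] subspace_add[OF R]
          subspace_add[OF T] subspace_scale[OF R] subspace_scale[OF T])
    show "R \<subseteq> C" using assms gR by (auto simp: C_def)
    show "C \<subseteq> T" by (auto simp: C_def)
    show "C \<inter> S \<subseteq> {0}" using assms gS by (auto simp: C_def)
    fix t assume t: "t \<in> T"
    obtain x y where xy: "x \<in> R" "y \<in> S" "g t = x + y" using g(1) by blast
    have "g (t - y) = x" using xy gS by (simp add: g.diff)
    moreover have "t - y \<in> T" using t xy assms by (auto intro: subspace_diff)
    ultimately have "t - y \<in> C" using xy by (simp add: C_def)
    then show "\<exists>c\<in>C. \<exists>s\<in>S. t = c + s" using xy(2) by (intro bexI[of _ "t - y"] bexI[of _ y]) auto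
  qed
qed

text \<open>
  Given such a splitting \<open>U\<^sub>0 \<oplus> U\<^sub>1\<close> of \<open>f(W)\<close>, the preimages \<open>T\<^sub>0 = f\<^sup>-\<^sup>1(U\<^sub>1)\<close> and \<open>T\<^sub>1 = f\<^sup>-\<^sup>1(U\<^sub>0)\<close> span \<open>W\<close>
  and meet in the kernel \<open>K\<close>. Splitting \<open>K = K\<^sub>0 \<oplus> K\<^sub>1\<close> with \<open>K\<^sub>0 = K \<inter> U\<^sub>0\<close> and \<open>K \<inter> U\<^sub>1 \<subseteq> K\<^sub>1\<close>, take for
  \<open>W\<^sub>0 \<supseteq> U\<^sub>0\<close> a complement of \<open>K\<^sub>1\<close> in \<open>T\<^sub>0\<close> and for \<open>W\<^sub>1 \<supseteq> U\<^sub>1 + K\<^sub>1\<close> a complement of \<open>K\<^sub>0\<close> in \<open>T\<^sub>1\<close>.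
\<close>

lemma nilpotent_swapped_decomposition:
  assumes f: "Vector_Spaces.linear scale scale f"
    and W: "subspace W" "f ` W \<subseteq> W" "\<forall>x\<in>W. (f ^^ k) x = 0"
  shows "\<exists>W0 W1. subspace W0 \<and> subspace W1 \<and> W0 \<subseteq> W \<and> W1 \<subseteq> W \<and> W0 \<inter> W1 \<subseteq> {0} \<and>
    (\<forall>x\<in>W. \<exists>y\<in>W0. \<exists>z\<in>W1. x = y + z) \<and> f ` W0 \<subseteq> W1 \<and> f ` W1 \<subseteq> W0"
  using W
proof (induction k arbitrary: W)
  case 0
  then have "W \<subseteq> {0}" by auto
  then have "W = {0}" using subspace_0[OF 0(1)] by auto
  with 0 show ?case by (intro exI[of _ "{0}"]) auto
next
  case (Suc k)
  interpret f: Vector_Spaces.linear scale scale f by fact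
  note W = Suc.prems(1,2)
  have fW: "subspace (f ` W)" "f ` f ` W \<subseteq> f ` W"
    using f.subspace_image[OF W(1)] W(2) by blast+
  have "\<forall>x\<in>f ` W. (f ^^ k) x = 0"
    using Suc.prems(3) by (auto simp: funpow_Suc_right simp del: funpow.simps)
  from Suc.IH[OF fW this] obtain U0 U1 where U: "subspace U0" "subspace U1" "U0 \<subseteq> f ` W"
    "U1 \<subseteq> f ` W" "U0 \<inter> U1 \<subseteq> {0}" "f ` U0 \<subseteq> U1" "f ` U1 \<subseteq> U0"
    and Usum: "\<forall>x\<in>f ` W. \<exists>y\<in>U0. \<exists>z\<in>U1. x = y + z"
    by (elim exE conjE) (rule that; assumption)
  define K where "K = {x \<in> W. f x \<in> {0}}"
  define T0 where "T0 = {x \<in> W. f x \<in> U1}"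
  define T1 where "T1 = {x \<in> W. f x \<in> U0}"
  have pre: "subspace {x \<in> W. f x \<in> U}" if U: "subspace U" for U
    by (rule subspaceI)
      (auto simp: f.add f.scale subspace_0[OF W(1)] subspace_0[OF U] subspace_add[OF W(1)]
        subspace_add[OF U] subspace_scale[OF W(1)] subspace_scale[OF U])
  have K: "subspace K" and T0: "subspace T0" and T1: "subspace T1"
    unfolding K_def T0_def T1_def by (rule pre U subspace_single_0)+
  have UT: "U0 \<subseteq> T0" "U1 \<subseteq> T1" using U W by (auto simp: T0_def T1_def)
  have KT: "K \<subseteq> T0" "K \<subseteq> T1" using subspace_0[OF U(1)] subspace_0[OF U(2)]
    by (auto simp: K_def T0_def T1_def)
  let ?K0 = "K \<inter> U0"
  have K0: "subspace ?K0" by (intro subspace_inter K U)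
  have KU1: "subspace (K \<inter> U1)" by (intro subspace_inter K U)
  obtain K1 where K1: "subspace K1" "K \<inter> U1 \<subseteq> K1" "K1 \<subseteq> K" "K1 \<inter> ?K0 \<subseteq> {0}"
    and Ksum: "\<And>t. t \<in> K \<Longrightarrow> \<exists>c\<in>K1. \<exists>s\<in>?K0. t = c + s"
    by (rule subspace_complement_containing[OF KU1 K0 K]) (use U in auto)
  obtain W0 where W0: "subspace W0" "U0 \<subseteq> W0" "W0 \<subseteq> T0" "W0 \<inter> K1 \<subseteq> {0}"
    and T0sum: "\<And>t. t \<in> T0 \<Longrightarrow> \<exists>c\<in>W0. \<exists>s\<in>K1. t = c + s"
    by (rule subspace_complement_containing[OF U(1) K1(1) T0]) (use UT KT K1 in auto)
  let ?R = "{x + y | x y. x \<in> U1 \<and> y \<in> K1}"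
  have R: "subspace ?R" by (rule subspace_sums[OF U(2) K1(1)])
  have RT: "?R \<subseteq> T1" using UT KT K1 T1 by (auto intro!: subspace_add)
  \<comment> \<open>If z = x + y lies in \<open>?K0\<close>, then x = z - y lies in both
    \<open>K\<close> and \<open>U1\<close>, hence in \<open>K1\<close>. So z lies in
    \<open>K1\<close> too, which meets \<open>?K0\<close> trivially.\<close>
  have RK: "?R \<inter> ?K0 \<subseteq> {0}"
  proof
    fix z assume "z \<in> ?R \<inter> ?K0"
    then obtain x y where xy: "x \<in> U1" "y \<in> K1" "z = x + y" "z \<in> K" "z \<in> U0" by auto
    have "x = z - y" using xy by simp
    then have "x \<in> K" using xy(2,4) K1(3) subspace_diff[OF K, of z y] by auto
    then have "x \<in> K1" using xy K1 by auto
    then have "z \<in> K1" using xy K1(1) by (auto intro: subspace_add)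
    then show "z \<in> {0}" using xy K1 by auto
  qed
  obtain W1 where W1: "subspace W1" "?R \<subseteq> W1" "W1 \<subseteq> T1" "W1 \<inter> ?K0 \<subseteq> {0}"
    and T1sum: "\<And>t. t \<in> T1 \<Longrightarrow> \<exists>c\<in>W1. \<exists>s\<in>?K0. t = c + s"
    by (rule subspace_complement_containing[OF R K0 T1 RT _ RK]) (use KT in auto)
  have U1W1: "U1 \<subseteq> W1" using W1(2) subspace_0[OF K1(1)] by force
  have K1W1: "K1 \<subseteq> W1" using W1(2) subspace_0[OF U(2)] by force
  \<comment> \<open>For z in both, f z lies in \<open>U0\<close> and \<open>U1\<close>, so z is in
    \<open>K\<close> and splits as c + s. As s lies in \<open>U0\<close>, hence in
    \<open>W0\<close>, c lies in \<open>W0\<close> and \<open>K1\<close> and is 0; then z = s lies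
    in \<open>W1\<close> and \<open>?K0\<close>.\<close>
  have "W0 \<inter> W1 \<subseteq> {0}"
  proof
    fix z assume z: "z \<in> W0 \<inter> W1"
    then have "f z \<in> U0 \<inter> U1" using W0 W1 by (auto simp: T0_def T1_def)
    then have "z \<in> K" using z W0(3) U(5) by (auto simp: K_def T0_def)
    then obtain c s where cs: "c \<in> K1" "s \<in> ?K0" "z = c + s" using Ksum by blast
    have "c = z - s" using cs by simp
    then have "c \<in> W0" using z cs(2) W0(2) subspace_diff[OF W0(1), of z s] by auto
    then have "c = 0" using cs W0 by auto
    then show "z \<in> {0}" using cs z W1 by auto
  qed
  \<comment> \<open>Lifting the \<open>U0\<close> part of f x to \<open>x1\<close> gives
    \<open>x1\<close> in \<open>T1\<close> and \<open>x - x1\<close> in \<open>T0\<close>. The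
    kernel parts then change sides: \<open>b\<close> in \<open>?K0\<close> joins \<open>W0\<close>,
    \<open>d\<close> in \<open>K1\<close> joins \<open>W1\<close>.\<close>
  moreover have "\<exists>y\<in>W0. \<exists>z\<in>W1. x = y + z" if x: "x \<in> W" for x
  proof -
    obtain u0 u1 where u: "u0 \<in> U0" "u1 \<in> U1" "f x = u0 + u1" using Usum x by blast
    obtain x1 where x1: "x1 \<in> W" "f x1 = u0" using u U by auto
    have "x1 \<in> T1" using x1 u by (simp add: T1_def)
    moreover have "x - x1 \<in> T0" using x x1 u W by (auto simp: T0_def f.diff intro: subspace_diff)
    ultimately obtain a b c d where
      abcd: "a \<in> W1" "b \<in> ?K0" "x1 = a + b" "c \<in> W0" "d \<in> K1" "x - x1 = c + d"
      using T0sum T1sum by metis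
    have "x = (b + c) + (a + d)" using abcd(3,6) by (simp add: algebra_simps)
    moreover have "b + c \<in> W0" "a + d \<in> W1"
      using abcd W0 W1 K1W1 by (auto intro!: subspace_add)
    ultimately show ?thesis by blast
  qed
  moreover have "f ` W0 \<subseteq> W1" "f ` W1 \<subseteq> W0" "W0 \<subseteq> W" "W1 \<subseteq> W"
    using W0 W1 U1W1 by (auto simp: T0_def T1_def)
  ultimately show ?case using W0(1) W1(1) by blast
qed

text \<open>With \<open>P\<close> the projection onto \<open>W0\<close> along \<open>W1\<close>,
  take f P and f (1 - P). The first has values in \<open>W1\<close>, where \<open>P\<close> is 0;
  the second has values in \<open>W0\<close>, where 1 - \<open>P\<close> is 0.\<close>

lemma nilpotent_sum_square_zero:
  assumes f: "Vector_Spaces.linear scale scale f" and nil: "\<And>x. (f ^^ k) x = 0"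
  obtains g h where "Vector_Spaces.linear scale scale g" "Vector_Spaces.linear scale scale h"
    "\<And>x. f x = g x + h x" "\<And>x. g (g x) = 0" "\<And>x. h (h x) = 0"
proof -
  interpret f: Vector_Spaces.linear scale scale f by fact
  have "\<exists>W0 W1. subspace W0 \<and> subspace W1 \<and> W0 \<subseteq> UNIV \<and> W1 \<subseteq> UNIV \<and> W0 \<inter> W1 \<subseteq> {0} \<and>
    (\<forall>x\<in>UNIV. \<exists>y\<in>W0. \<exists>z\<in>W1. x = y + z) \<and> f ` W0 \<subseteq> W1 \<and> f ` W1 \<subseteq> W0"
    by (rule nilpotent_swapped_decomposition[OF f, of _ k]) (use nil in auto)
  then obtain W0 W1 where W: "subspace W0" "subspace W1" "W0 \<inter> W1 \<subseteq> {0}"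
      "f ` W0 \<subseteq> W1" "f ` W1 \<subseteq> W0"
    and ex: "\<And>x. \<exists>y\<in>W0. \<exists>z\<in>W1. x = y + z"
    by auto
  \<comment> \<open>Trivial intersection makes the chosen component unique (\<open>Peq\<close>), and
    uniqueness yields linearity.\<close>
  define P where "P x = (SOME y. y \<in> W0 \<and> x - y \<in> W1)" for x
  have P: "P x \<in> W0 \<and> x - P x \<in> W1" for x
    unfolding P_def by (rule someI_ex) (use ex[of x] in force)
  have Peq: "P x = y" if "y \<in> W0" "x - y \<in> W1" for x y
  proof -
    have "P x - y \<in> W0" using P that W by (auto intro: subspace_diff)
    moreover have "P x - y = (x - y) - (x - P x)" by simp
    then have "P x - y \<in> W1" using P that W by (metis subspace_diff)
    ultimately show ?thesis using W(3) by auto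
  qed
  have P_add: "P (x + y) = P x + P y" for x y
  proof (rule Peq)
    show "P x + P y \<in> W0" using P W by (auto intro: subspace_add)
    have "x + y - (P x + P y) = (x - P x) + (y - P y)" by simp
    then show "x + y - (P x + P y) \<in> W1" using P W by (metis subspace_add)
  qed
  have P_scale: "P (scale c x) = scale c (P x)" for c x
  proof (rule Peq)
    show "scale c (P x) \<in> W0" using P W by (auto intro: subspace_scale)
    show "scale c x - scale c (P x) \<in> W1"
      using P W by (metis scale_right_diff_distrib subspace_scale)
  qed
  have P0: "P x = 0" if "x \<in> W1" for x
    using that W(1) by (intro Peq) (auto intro: subspace_0)
  have P1: "P x = x" if "x \<in> W0" for x
    using that W(2) by (intro Peq) (auto intro: subspace_0)
  show ?thesis
  proof
    show "Vector_Spaces.linear scale scale (\<lambda>x. f (P x))"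
      by unfold_locales (simp_all add: P_add P_scale f.add f.scale)
    show "Vector_Spaces.linear scale scale (\<lambda>x. f (x - P x))"
      by unfold_locales
        (simp_all add: P_add P_scale f.add f.scale f.diff algebra_simps)
    show "f x = f (P x) + f (x - P x)" for x by (simp flip: f.add)
    have "f (P x) \<in> W1" for x using P W by blast
    then show "f (P (f (P x))) = 0" for x by (simp add: P0 f.zero)
    have "f (x - P x) \<in> W0" for x using P W by blast
    then show "f (f (x - P x) - P (f (x - P x))) = 0" for x by (simp add: P1 f.zero)
  qed
qed

end

section \<open>Coordinates: from the matrix back to the endomorphism\<close>

context vector_space
begin

lemma coords_matrix_of:
  assumes bs: "ordered_basis scale bs" and f: "Vector_Spaces.linear scale scale f"
  defines "coords x \<equiv> vec (length bs) (\<lambda>i. representation (set bs) x (bs ! i))"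
  shows "matrix_of scale bs f *\<^sub>v coords x = coords (f x)"
proof (rule eq_vecI)
  let ?B = "set bs"
  have B: "independent ?B" "span ?B = UNIV" "distinct bs"
    using bs by (auto simp: ordered_basis_def)
  interpret f: Vector_Spaces.linear scale scale f by fact
  fix i assume "i < dim_vec (coords (f x))"
  then have i: "i < length bs" by (simp add: coords_def)
  interpret r: Vector_Spaces.linear scale "(*)" "\<lambda>x. representation ?B x (bs ! i)"
    by (rule linear_representation[OF B(1,2)])
  have "x = (\<Sum>b\<in>?B. scale (representation ?B x b) b)"
    using sum_representation_eq[OF B(1), of x ?B] B(2) by simp
  also have "\<dots> = (\<Sum>j<length bs. scale (representation ?B x (bs ! j)) (bs ! j))"
    by (rule sum.reindex_bij_betw[symmetric]) (use bij_betw_nth[OF B(3) refl refl] in simp)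
  finally have "representation ?B (f x) (bs ! i) =
      representation ?B (f (\<Sum>j<length bs. scale (representation ?B x (bs ! j)) (bs ! j))) (bs ! i)"
    by simp
  also have "\<dots> = (\<Sum>j<length bs. representation ?B x (bs ! j) * representation ?B (f (bs ! j)) (bs ! i))"
    by (simp only: f.sum f.scale r.sum r.scale)
  finally show "(matrix_of scale bs f *\<^sub>v coords x) $ i = coords (f x) $ i"
    using i
    by (simp add: matrix_of_def coords_def scalar_prod_def lessThan_atLeast0 mult.commute)
qed (simp add: matrix_of_def coords_def)

text \<open>Taking coordinates intertwines the shifted endomorphism with the shifted matrix, and a
  vector with zero coordinates is zero.\<close>

lemma funpow_eq_0_if_matrix_of_nilpotent:
  assumes bs: "ordered_basis scale bs" and v: "Vector_Spaces.linear scale scale v"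
    and nil: "(matrix_of scale bs v - c \<cdot>\<^sub>m 1\<^sub>m (length bs)) ^\<^sub>m k = 0\<^sub>m (length bs) (length bs)"
  shows "((\<lambda>x. v x - scale c x) ^^ k) x = 0"
proof -
  let ?B = "set bs" and ?n = "length bs" and ?f = "\<lambda>x. v x - scale c x"
  let ?M = "matrix_of scale bs v"
  let ?A = "?M - c \<cdot>\<^sub>m 1\<^sub>m ?n"
  have B: "independent ?B" "span ?B = UNIV"
    using bs by (auto simp: ordered_basis_def)
  define coords where "coords x = vec ?n (\<lambda>i. representation ?B x (bs ! i))" for x
  have M: "?M \<in> carrier_mat ?n ?n" by (simp add: matrix_of_def)
  then have A: "?A \<in> carrier_mat ?n ?n" by (intro minus_carrier_mat) auto
  have coords: "coords x \<in> carrier_vec ?n" for x by (simp add: coords_def)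
  have step: "coords (?f x) = ?A *\<^sub>v coords x" for x
  proof -
    have one: "(c \<cdot>\<^sub>m 1\<^sub>m ?n) *\<^sub>v coords x = c \<cdot>\<^sub>v coords x"
      using coords[of x] by (intro eq_vecI) auto
    have "coords (?f x) = coords (v x) - c \<cdot>\<^sub>v coords x"
      using B by (intro eq_vecI) (auto simp: coords_def representation_diff representation_scale)
    also have "coords (v x) = ?M *\<^sub>v coords x"
      unfolding coords_def by (rule coords_matrix_of[OF bs v, symmetric])
    finally show ?thesis
      using one minus_mult_distrib_mat_vec[OF M, of "c \<cdot>\<^sub>m 1\<^sub>m ?n" "coords x"] coords by simp
  qed
  have pow: "coords ((?f ^^ k) x) = ?A ^\<^sub>m k *\<^sub>v coords x" for k x
  proof (induction k arbitrary: x)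
    case 0
    then show ?case using A coords by simp
  next
    case (Suc k)
    have "coords ((?f ^^ Suc k) x) = ?A ^\<^sub>m k *\<^sub>v (?A *\<^sub>v coords x)"
      using Suc[of "?f x"] by (simp add: funpow_Suc_right step del: funpow.simps)
    then show ?case
      using assoc_mult_mat_vec[OF pow_carrier_mat[OF A] A coords] by simp
  qed
  have eq0: "coords ((?f ^^ k) x) = 0\<^sub>v ?n"
    unfolding pow nil using coords[of x] by (intro eq_vecI) auto
  have "representation ?B ((?f ^^ k) x) b = 0" if b: "b \<in> ?B" for b
  proof -
    obtain i where "i < ?n" "b = bs ! i" using b by (auto simp: in_set_conv_nth)
    then show ?thesis using eq0 by (auto simp: coords_def vec_eq_iff)
  qed
  then show ?thesis
    using sum_representation_eq[OF B(1), of "(?f ^^ k) x" ?B] B(2) by simp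
qed

end

section \<open>The space of the symplectic extension, its form and the lifted endomorphisms\<close>

lemma linear_scale_add:
  assumes "Vector_Spaces.linear s s f"
  shows "Vector_Spaces.linear s s (\<lambda>x. s a x + f x)"
proof -
  interpret f: Vector_Spaces.linear s s f by fact
  show ?thesis
    by unfold_locales
      (simp_all add: f.add f.scale algebra_simps f.vs1.scale_left_commute)
qed

lemma vector_space_ext_scale:
  assumes "vector_space s"
  shows "vector_space (ext_scale s)"
proof -
  interpret vector_space s by fact
  show ?thesis
    by unfold_locales
      (auto simp: ext_scale_def algebra_simps fun_eq_iff plus_fun_def)
qed

lemma mem_dual_space_iff:
  assumes "vector_space s"
  shows "\<phi> \<in> dual_space s \<longleftrightarrow>
    (\<forall>x y. \<phi> (x + y) = \<phi> x + \<phi> y) \<and> (\<forall>c x. \<phi> (s c x) = c * \<phi> x)"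
proof -
  have "vector_space ((*) :: 'a \<Rightarrow> _)"
    by unfold_locales (simp_all add: algebra_simps)
  with assms show ?thesis
    by (simp add: dual_space_def Vector_Spaces.linear_iff)
qed

lemma subspace_ext_space:
  assumes "vector_space s"
  shows "module.subspace (ext_scale s) (ext_space s)"
proof -
  interpret E: vector_space "ext_scale s" by (rule vector_space_ext_scale) fact
  show ?thesis
    by (rule E.subspaceI)
      (auto simp: ext_space_def ext_scale_def mem_dual_space_iff[OF assms] zero_prod_def
        plus_fun_def zero_fun_def ring_distribs)
qed

lemma findim_ext_space:
  assumes "finite_dimensional_vector_space s B"
  shows "findim_space (ext_scale s) (ext_space s)"
proof -
  interpret finite_dimensional_vector_space s B by fact
  have vs: "vector_space s" by unfold_locales
  interpret E: vector_space "ext_scale s" by (rule vector_space_ext_scale) fact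
  have W: "E.subspace (ext_space s)" by (rule subspace_ext_space[OF vs])
  define d where "d b x = representation B x b" for b x
  have d: "Vector_Spaces.linear s (*) (d b)" for b
    unfolding d_def by (rule linear_representation) (auto simp: independent_Basis span_Basis)
  have linear_zero: "Vector_Spaces.linear s (*) (0 :: 'b \<Rightarrow> 'a)"
    using mem_dual_space_iff[OF vs, of 0] by (simp add: dual_space_def)
  \<comment> \<open>The basis together with its dual basis \<open>d\<close>; a functional is the
    combination of the \<open>d b\<close> with coefficients its values at the
    \<open>b\<close>.\<close>
  define G where "G = (\<lambda>b. (b, 0)) ` B \<union> (\<lambda>b. (0, d b)) ` B"
  have G: "G \<subseteq> ext_space s"
    using d by (auto simp: G_def ext_space_def dual_space_def linear_zero)
  have rep: "(\<Sum>b\<in>B. s (d b x) b) = x" for x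
    unfolding d_def
    by (rule sum_representation_eq) (auto simp: independent_Basis span_Basis finite_Basis)
  have "ext_space s \<subseteq> E.span G"
  proof
    fix w assume "w \<in> ext_space s"
    then obtain x \<phi> where w: "w = (x, \<phi>)" and \<phi>: "Vector_Spaces.linear s (*) \<phi>"
      by (auto simp: ext_space_def dual_space_def)
    interpret \<phi>: Vector_Spaces.linear s "(*)" \<phi> by fact
    have sum_apply: "(\<Sum>b\<in>A. F b) y = (\<Sum>b\<in>A. F b y)" for A and F :: "'b \<Rightarrow> 'b \<Rightarrow> 'a" and y
      by (induction A rule: infinite_finite_induct) auto
    have \<phi>_eq: "(\<Sum>b\<in>B. (\<lambda>y. \<phi> b * d b y)) = \<phi>"
    proof
      fix y
      have "(\<Sum>b\<in>B. (\<lambda>y. \<phi> b * d b y)) y = \<phi> (\<Sum>b\<in>B. s (d b y) b)"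
        by (simp only: sum_apply \<phi>.sum \<phi>.scale mult.commute)
      then show "(\<Sum>b\<in>B. (\<lambda>y. \<phi> b * d b y)) y = \<phi> y" by (simp only: rep)
    qed
    have "(\<Sum>b\<in>B. ext_scale s (d b x) (b, 0)) = (x, 0)"
      by (simp add: ext_scale_def sum_prod rep sum.neutral flip: zero_fun_def)
    moreover have "(\<Sum>b\<in>B. ext_scale s (\<phi> b) (0, d b)) = (0, \<phi>)"
      by (simp add: ext_scale_def sum_prod \<phi>_eq)
    ultimately have "w = (\<Sum>b\<in>B. ext_scale s (d b x) (b, 0)) + (\<Sum>b\<in>B. ext_scale s (\<phi> b) (0, d b))"
      by (simp add: w)
    also have "\<dots> \<in> E.span G"
      by (intro E.span_add E.span_sum E.span_scale E.span_base) (auto simp: G_def)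
    finally show "w \<in> E.span G" .
  qed
  then have "E.span G = ext_space s" using E.span_minimal[OF G W] by auto
  moreover have "finite G" by (simp add: G_def finite_Basis)
  ultimately show ?thesis
    using W E.vector_space_axioms by (auto simp: findim_space_def)
qed

lemma symplectic_ext_form:
  assumes "finite_dimensional_vector_space s B"
  shows "symplectic_form_on (ext_scale s) (ext_space s) ext_form"
proof -
  interpret finite_dimensional_vector_space s B by fact
  have vs: "vector_space s" by unfold_locales
  have d: "(\<lambda>x. representation B x b) \<in> dual_space s" for b
    unfolding dual_space_def mem_Collect_eq
    by (rule linear_representation) (auto simp: independent_Basis span_Basis)
  have z: "(\<lambda>x. 0) \<in> dual_space s"
    by (simp add: mem_dual_space_iff[OF vs])
  \<comment> \<open>Pairing with (y, 0) forces the functional to vanish; pairing with the coordinate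
    functionals then kills every coordinate of \<open>x\<close>.\<close>
  have nondeg: "x = 0 \<and> \<phi> = 0"
    if eq: "\<And>y \<psi>. \<psi> \<in> dual_space s \<Longrightarrow> \<phi> y - \<psi> x = 0" for x \<phi>
  proof
    show \<phi>: "\<phi> = 0" using eq[OF z] by (simp add: fun_eq_iff)
    have "representation B x b = 0" for b using eq[OF d[of b]] \<phi> by simp
    then show "x = 0"
      using sum_representation_eq[OF independent_Basis, of x B] by (simp add: span_Basis finite_Basis)
  qed
  have "bilinear_form_on (ext_scale s) (ext_space s) ext_form"
    by (auto simp: bilinear_form_on_def ext_space_def ext_scale_def ext_form_def
        mem_dual_space_iff[OF vs] plus_fun_def algebra_simps)
  moreover have "\<forall>w\<in>ext_space s. ext_form w w = 0"
    by (auto simp: ext_form_def)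
  moreover have "w = 0" if "\<forall>w'\<in>ext_space s. ext_form w w' = 0" for w
    using nondeg[of "snd w" "fst w"] that
    by (cases w) (auto simp: ext_space_def ext_form_def zero_prod_def)
  ultimately show ?thesis by (auto simp: symplectic_form_on_def)
qed

text \<open>Both terms of the form at (x, \<phi>) and its image equal \<phi>(f x), so they
  cancel.\<close>

lemma alternating_ext_endo:
  assumes f: "Vector_Spaces.linear s s f"
  shows "alternating_endo_on (ext_scale s) (ext_space s) ext_form (ext_endo f)"
proof -
  interpret f: Vector_Spaces.linear s s f by fact
  show ?thesis
    by (auto simp: alternating_endo_on_def endomorphism_on_def ext_endo_def ext_space_def
        ext_scale_def ext_form_def mem_dual_space_iff[OF f.vs1.vector_space_axioms]
        f.add f.scale fun_eq_iff)
qed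

text \<open>The polynomial (t - a)^2 sends a + g to g^2 = 0; on the dual component the same identity
  is composed with a functional.\<close>

lemma poly_endo_ext_endo_eq_0:
  fixes s :: "'a::field \<Rightarrow> 'b::ab_group_add \<Rightarrow> 'b"
  assumes g: "Vector_Spaces.linear s s g" and sq: "\<And>x. g (g x) = 0"
    and w: "w \<in> ext_space s"
  shows "poly_endo (ext_scale s) ([:- a, 1:] ^ 2) (ext_endo (\<lambda>x. s a x + g x)) w = 0"
proof -
  interpret g: Vector_Spaces.linear s s g by fact
  obtain x \<phi> where xf: "w = (x, \<phi>)" and \<phi>: "Vector_Spaces.linear s (*) \<phi>"
    using w by (auto simp: ext_space_def dual_space_def)
  interpret \<phi>: Vector_Spaces.linear s "(*)" \<phi> by fact
  have p: "[:- a, 1:] ^ 2 = [:a * a, - (2 * a), 1:]"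
    by (simp add: power2_eq_square)
  have vec: "s (a * a) y + s (- (2 * a)) (s a y + g y) + (s a (s a y + g y) + g (s a y + g y)) = 0" for y
  proof -
    have neg: "s (- (2 * a)) z = - s a z - s a z" for z
      by (simp only: mult_2 g.vs1.scale_minus_left g.vs1.scale_left_distrib) simp
    \<comment> \<open>Here \<open>P\<close> stands for \<open>s a (s a y)\<close>, \<open>Q\<close>
      for \<open>s a (g y)\<close>, and the final 0 for \<open>g (g y)\<close>. The cancellation
      holds in any abelian group, hence in every characteristic.\<close>
    have cancel: "P + (- P - P + (- Q - Q)) + (P + Q + (Q + 0)) = 0" for P Q :: 'b
      by simp
    show ?thesis
      by (simp only: neg g.add g.scale sq g.vs1.scale_right_distrib
          g.vs1.scale_scale[symmetric, of a a] cancel)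
  qed
  have "\<phi> (s (a * a) y + s (- (2 * a)) (s a y + g y) + (s a (s a y + g y) + g (s a y + g y))) = 0" for y
    by (simp only: vec \<phi>.zero)
  then have fn: "a * a * \<phi> y + - (2 * a) * \<phi> (s a y + g y) + \<phi> (s a (s a y + g y) + g (s a y + g y)) = 0" for y
    by (simp only: \<phi>.add \<phi>.scale)
  have "poly_endo (ext_scale s) [:a * a, - (2 * a), 1:] (ext_endo (\<lambda>x. s a x + g x)) w = 0"
    using vec[of x] fn
    by (simp add: poly_endo_def numeral_2_eq_2 ext_scale_def ext_endo_def xf zero_prod_def fun_eq_iff)
  then show ?thesis by (simp add: p)
qed

section \<open>The single eigenvalue and the final decomposition\<close>

lemma Root_square: "Root ([:- a, 1:] ^ 2) = {to_ac a}"
proof -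
  have "map_poly to_ac ([:- a, 1:] ^ 2) = [:- to_ac a, 1:] ^ 2"
    by (simp add: power2_eq_square map_poly_pCons)
  then show ?thesis by (auto simp: Root_def)
qed

theorem theorem4p2:
  fixes scale :: "'a::field \<Rightarrow> 'b::ab_group_add \<Rightarrow> 'b"
    and Basis :: "'b set"
    and p q :: "'a poly"
    and v :: "'b \<Rightarrow> 'b"
  assumes "finite_dimensional_vector_space scale Basis"
    and "lead_coeff p = 1" and "degree p = 2"
    and "lead_coeff q = 1" and "degree q = 2"
    and "\<exists>a. p = [:- a, 1:] ^ 2"
    and "\<exists>a. q = [:- a, 1:] ^ 2"
    and "Vector_Spaces.linear scale scale v"
    and "exceptional scale p q v"
  shows "symplectic_difference (ext_scale scale) (ext_space scale) p q (symplectic_extension v)"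
proof -
  interpret finite_dimensional_vector_space scale Basis by fact
  interpret v: Vector_Spaces.linear scale scale v by fact
  obtain a b where p: "p = [:- a, 1:] ^ 2" and q: "q = [:- b, 1:] ^ 2"
    using assms(6,7) by blast
  obtain bs where bs: "set bs = Basis" "distinct bs"
    using finite_distinct_list[OF finite_Basis] by blast
  then have ob: "ordered_basis scale bs"
    by (simp add: ordered_basis_def independent_Basis span_Basis)
  let ?c = "a - b" and ?M = "matrix_of scale bs v"
  \<comment> \<open>A double root makes each root set a singleton, so \<open>Root_diff p q\<close>
    contains only the image of a - b.\<close>
  have "z = to_ac ?c" if "eigenvalue (map_mat to_ac ?M) z" for z
  proof -
    have "z \<in> Root_diff p q"
      using that ob assms(9) by (auto simp: exceptional_def closure_eigenvalues_def)
    then show ?thesis by (auto simp: Root_diff_def p q Root_square)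
  qed
  then have "(?M - ?c \<cdot>\<^sub>m 1\<^sub>m (length bs)) ^\<^sub>m length bs = 0\<^sub>m (length bs) (length bs)"
    by (intro nilpotent_if_single_closure_eigenvalue) (simp_all add: matrix_of_def)
  then have nil: "((\<lambda>x. v x - scale ?c x) ^^ length bs) x = 0" for x
    by (rule funpow_eq_0_if_matrix_of_nilpotent[OF ob assms(8)])
  have "Vector_Spaces.linear scale scale (\<lambda>x. v x - scale ?c x)"
    by unfold_locales
      (simp_all add: v.add v.scale scale_right_distrib scale_right_diff_distrib mult.commute)
  then obtain g h where g: "Vector_Spaces.linear scale scale g" "\<And>x. g (g x) = 0"
    and h: "Vector_Spaces.linear scale scale h" "\<And>x. h (h x) = 0"
    and gh: "\<And>x. v x - scale ?c x = g x + h x"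
    using nilpotent_sum_square_zero[OF _ nil] by metis
  interpret h: Vector_Spaces.linear scale scale h by fact
  \<comment> \<open>The second summand is b - h, so the square-zero map to be lifted is the negative
    of \<open>h\<close>.\<close>
  have h': "Vector_Spaces.linear scale scale (\<lambda>x. - h x)"
    by unfold_locales (simp_all add: h.add h.scale)
  let ?u1 = "\<lambda>x. scale a x + g x" and ?u2 = "\<lambda>x. scale b x + - h x"
  have v_eq: "v x = ?u1 x - ?u2 x" for x
    using gh[of x] by (simp add: algebra_simps)
  have "ext_endo v w = ext_endo ?u1 w - ext_endo ?u2 w" if w': "w \<in> ext_space scale" for w
  proof -
    obtain x \<phi> where w: "w = (x, \<phi>)" and \<phi>: "Vector_Spaces.linear scale (*) \<phi>"
      using w' by (auto simp: ext_space_def dual_space_def)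
    interpret \<phi>: Vector_Spaces.linear scale "(*)" \<phi> by fact
    \<comment> \<open>Transposition respects the difference because \<phi> is linear.\<close>
    have "\<phi> \<circ> v = (\<phi> \<circ> ?u1) - (\<phi> \<circ> ?u2)"
      by (simp only: fun_eq_iff comp_def minus_apply v_eq \<phi>.diff simp_thms)
    then show ?thesis using v_eq[of x] by (simp add: w ext_endo_def)
  qed
  moreover have "symplectic_pair (ext_scale scale) (ext_space scale) (ext_form, ext_endo v)"
    by (simp add: symplectic_pair_def findim_ext_space[OF assms(1)] symplectic_ext_form[OF assms(1)]
        alternating_ext_endo[OF assms(8)])
  moreover have "alternating_endo_on (ext_scale scale) (ext_space scale) ext_form (ext_endo ?u1)"
    "alternating_endo_on (ext_scale scale) (ext_space scale) ext_form (ext_endo ?u2)"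
    by (intro alternating_ext_endo linear_scale_add g h')+
  moreover have "\<forall>w\<in>ext_space scale. poly_endo (ext_scale scale) p (ext_endo ?u1) w = 0"
    unfolding p using poly_endo_ext_endo_eq_0[OF g] by blast
  moreover have "\<forall>w\<in>ext_space scale. poly_endo (ext_scale scale) q (ext_endo ?u2) w = 0"
    unfolding q using poly_endo_ext_endo_eq_0[OF h'] h(2) by (simp add: h.neg)
  ultimately show ?thesis
    unfolding symplectic_difference_def symplectic_extension_def prod.case by blast
qed

end
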